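(* Strong phase-access quotient-space real quantum mechanics on a ray domain $\mathcal{R}$ induces an operational phase convention on $\mathcal{R}$. Hence $\mathcal{R}$ is overlap-determinable in the corresponding scenario.
   Context: Let $H\simeq\mathbb{C}^d$ be a complex Hilbert space. A ray is a rank-one projector $P_\psi=|\psi\rangle\langle\psi|$ with $\|\psi\|=1$, and $\mathcal{R}\subseteq\mathbb{P}(H)$ is a set of rays. A phase convention on $\mathcal{R}$ is a map $\Gamma$ assigning to each ray $P_\psi\in\mathcal{R}$ a normalized representative $|\psi_\Gamma\rangle$ with $P_\psi=|\psi_\Gamma\rangle\langle\psi_\Gamma|$. The domain $\mathcal{R}$ is overlap-determinable (OD) in a physical scenario if that scenario supplies such a convention operationally, so that $\langle\psi_\Gamma|\phi_\Gamma\rangle$ is a definite complex datum for all relevant rays. Quotient-space real quantum mechanics represents a complex vector $\psi$, in a fixed basis, by the real vector $S(\psi)=\operatorname{Re}\psi\otimes|0\rangle_F+\operatorname{Im}\psi\otimes|1\rangle_F\in V=\mathbb{R}^d\otimes\mathbb{R}^2$, where the factor $\mathbb{R}^2$, with standard basis $|0\rangle_F,|1\rangle_F$, is called the flag. Multiplication by $i$ becomes $J=I_d\otimes J_F$ with $J_F|0\rangle_F=|1\rangle_F$, $J_F|1\rangle_F=-|0\rangle_F$, so $J^2=-\mathbb{1}$ and $S(e^{i\alpha}\psi)=e^{\alpha J}S(\psi)$; a complex ray corresponds to an orbit $v\sim e^{\alpha J}v$, $\alpha\in\mathbb{R}$. A real flag theory is in the access branch if some physical effect, instrument, or dynamical coupling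 does not commute with the relevant $J$ and therefore can distinguish, control, or decohere points on the orbit $v\sim e^{\alpha J}v$. Strong phase-access quotient-space real quantum mechanics is an access-branch real theory with the following operational primitive: for arbitrary unknown pure inputs from a tested domain (here $\mathcal{R}$), the flag sector can be read and coherently controlled so as to implement convention-fixed interference operations; equivalently, the theory supplies an OD convention on that domain. *)

theory Defs
  imports "HOL-Analysis.Analysis"
begin

section \<open>Rays and phase conventions\<close>

definition braket :: "complex^'n \<Rightarrow> complex^'n \<Rightarrow> complex" where
  "braket \<phi> \<psi> = (\<Sum>i\<in>UNIV. cnj (\<phi> $ i) * \<psi> $ i)"

definition ray_proj :: "complex^'n \<Rightarrow> complex^'n^'n" where
  "ray_proj \<psi> = (\<chi> i j. \<psi> $ i * cnj (\<psi> $ j))"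

definition rays :: "(complex^'n^'n) set" where
  "rays = {ray_proj \<psi> | \<psi>. norm \<psi> = 1}"

definition phase_convention ::
    "(complex^'n^'n) set \<Rightarrow> (complex^'n^'n \<Rightarrow> complex^'n) \<Rightarrow> bool" where
  "phase_convention R \<Gamma> \<longleftrightarrow> (\<forall>P\<in>R. norm (\<Gamma> P) = 1 \<and> P = ray_proj (\<Gamma> P))"


section \<open>Physical scenarios and overlap-determinability\<close>

text \<open>
  A scenario works with preparations of a type \<^typ>\<open>'x\<close>. Each preparation has an amplitude
  vector that describes it, but the experimenter is told only that the ray lies in the tested
  domain. The scenario consists of its preparations, its procedures on one input, and its
  two-input tests; a test is given by the probability of its positive outcome.
\<close>

record ('x, 'n) scenario =
  preparations :: "'x set"
  amplitude :: "'x \<Rightarrow> complex^'n"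
  procedures :: "('x \<Rightarrow> 'x) set"
  pair_tests :: "('x \<Rightarrow> 'x \<Rightarrow> real) set"

definition prepared_ray :: "('x, 'n) scenario \<Rightarrow> 'x \<Rightarrow> complex^'n^'n" where
  "prepared_ray \<S> x = ray_proj (amplitude \<S> x)"

definition inputs :: "('x, 'n) scenario \<Rightarrow> (complex^'n^'n) set \<Rightarrow> 'x set" where
  "inputs \<S> R = {x \<in> preparations \<S>. prepared_ray \<S> x \<in> R}"

text \<open>
  A convention is operational when one procedure, the same for all inputs from the domain,
  turns every input into a preparation of the chosen representative of its ray.
\<close>

definition operational_phase_convention ::
    "('x, 'n) scenario \<Rightarrow> (complex^'n^'n) set \<Rightarrow> (complex^'n^'n \<Rightarrow> complex^'n) \<Rightarrow> bool" where
  "operational_phase_convention \<S> R \<Gamma> \<longleftrightarrow>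
     phase_convention R \<Gamma> \<and>
     (\<exists>C\<in>procedures \<S>. \<forall>x\<in>inputs \<S> R.
        C x \<in> preparations \<S> \<and> amplitude \<S> (C x) = \<Gamma> (prepared_ray \<S> x))"

text \<open>
  A complex function of pairs of rays is a definite datum when finitely many available tests
  and a fixed classical post-processing of their probabilities return its value, whichever
  preparations of the two rays were supplied.
\<close>

definition definite_datum ::
    "('x, 'n) scenario \<Rightarrow> (complex^'n^'n) set \<Rightarrow>
     (complex^'n^'n \<Rightarrow> complex^'n^'n \<Rightarrow> complex) \<Rightarrow> bool" where
  "definite_datum \<S> R q \<longleftrightarrow>
     (\<exists>ps f. set ps \<subseteq> pair_tests \<S> \<and>
        (\<forall>x\<in>inputs \<S> R. \<forall>y\<in>inputs \<S> R.
           f (map (\<lambda>p. p x y) ps) = q (prepared_ray \<S> x) (prepared_ray \<S> y)))"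

definition overlap_determinable ::
    "('x, 'n) scenario \<Rightarrow> (complex^'n^'n) set \<Rightarrow> bool" where
  "overlap_determinable \<S> R \<longleftrightarrow>
     (\<exists>\<Gamma>. operational_phase_convention \<S> R \<Gamma> \<and>
          definite_datum \<S> R (\<lambda>P Q. braket (\<Gamma> P) (\<Gamma> Q)))"


section \<open>The quotient-space real representation\<close>

definition tensor_vec :: "real^'a \<Rightarrow> real^'b \<Rightarrow> real^('a \<times> 'b)"  (infixr "\<otimes>\<^sub>v" 70) where
  "u \<otimes>\<^sub>v w = (\<chi> k. u $ fst k * w $ snd k)"

definition tensor_mat ::
    "real^'a^'a \<Rightarrow> real^'b^'b \<Rightarrow> real^('a \<times> 'b)^('a \<times> 'b)"  (infixr "\<otimes>\<^sub>m" 70) where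
  "A \<otimes>\<^sub>m B = (\<chi> k l. A $ fst k $ fst l * B $ snd k $ snd l)"

text \<open>The index type \<^typ>\<open>2\<close> has the elements \<^term>\<open>0 :: 2\<close> and \<^term>\<open>1 :: 2\<close>.\<close>

type_synonym 'n flag_vec = "real^('n \<times> 2)"
type_synonym 'n flag_op = "real^('n \<times> 2)^('n \<times> 2)"

definition flag0 :: "real^2" where "flag0 = axis 0 1"
definition flag1 :: "real^2" where "flag1 = axis 1 1"

definition flag_embed :: "complex^'n \<Rightarrow> 'n flag_vec" where
  "flag_embed \<psi> = (\<chi> i. Re (\<psi> $ i)) \<otimes>\<^sub>v flag0 + (\<chi> i. Im (\<psi> $ i)) \<otimes>\<^sub>v flag1"

definition J_F :: "real^2^2" where
  "J_F = (\<chi> a b. if a = 1 \<and> b = 0 then 1 else if a = 0 \<and> b = 1 then -1 else 0)"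

definition flag_J :: "'n::finite flag_op" where
  "flag_J = mat 1 \<otimes>\<^sub>m J_F"

text \<open>The action of the exponential of \<open>\<alpha> J\<close>, as its power series.\<close>

definition exp_J :: "real \<Rightarrow> 'n::finite flag_vec \<Rightarrow> 'n flag_vec" where
  "exp_J \<alpha> v = (\<Sum>k. (\<alpha> ^ k / fact k) *\<^sub>R (((*v) flag_J ^^ k) v))"


section \<open>Real flag theories\<close>

text \<open>
  The physical content of a real flag theory. An instrument is the list of its outcomes, each
  outcome being the list of its Kraus operators. A dynamical coupling is an orthogonal operator
  on the flag space and an environment with index type \<^typ>\<open>'e\<close>. A flag reading returns an angle
  for an input vector. Readings, controls and two-input tests are arbitrary functions of the
  input vectors because the phase-access primitive posits them for unknown inputs and does not
  build them from the linear operations.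
\<close>

record ('n, 'e) flag_theory =
  effects :: "(real^('n \<times> 2)^('n \<times> 2)) set"
  instruments :: "(real^('n \<times> 2)^('n \<times> 2)) list list set"
  couplings :: "(real^(('n \<times> 2) \<times> 'e)^(('n \<times> 2) \<times> 'e)) set"
  flag_readings :: "(real^('n \<times> 2) \<Rightarrow> real) set"
  flag_controls :: "(real^('n \<times> 2) \<Rightarrow> real^('n \<times> 2)) set"
  flag_tests :: "(real^('n \<times> 2) \<Rightarrow> real^('n \<times> 2) \<Rightarrow> real) set"

definition is_effect :: "real^'m^'m \<Rightarrow> bool" where
  "is_effect E \<longleftrightarrow> transpose E = E \<and> (\<forall>v. 0 \<le> v \<bullet> (E *v v) \<and> v \<bullet> (E *v v) \<le> v \<bullet> v)"

definition is_instrument :: "(real^'m^'m) list list \<Rightarrow> bool" where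
  "is_instrument I \<longleftrightarrow> (\<Sum>K\<leftarrow>concat I. transpose K ** K) = mat 1"

definition real_flag_theory :: "('n::finite, 'e::finite) flag_theory \<Rightarrow> bool" where
  "real_flag_theory T \<longleftrightarrow>
     (\<forall>E\<in>effects T. is_effect E) \<and>
     (\<forall>I\<in>instruments T. is_instrument I) \<and>
     (\<forall>U\<in>couplings T. orthogonal_matrix U) \<and>
     (\<forall>C\<in>flag_controls T. \<forall>v. norm v = 1 \<longrightarrow> norm (C v) = 1) \<and>
     (\<forall>p\<in>flag_tests T. \<forall>v w. norm v = 1 \<longrightarrow> norm w = 1 \<longrightarrow> 0 \<le> p v w \<and> p v w \<le> 1)"

text \<open>
  For an instrument, commuting with \<open>J\<close> is required of all its Kraus operators. It does not
  depend on the chosen Kraus decomposition, since two decompositions of one outcome have the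
  same linear span.
\<close>

definition access_branch :: "('n::finite, 'e::finite) flag_theory \<Rightarrow> bool" where
  "access_branch T \<longleftrightarrow>
     (\<exists>E\<in>effects T. E ** flag_J \<noteq> flag_J ** E) \<or>
     (\<exists>I\<in>instruments T. \<exists>K\<in>set (concat I). K ** flag_J \<noteq> flag_J ** K) \<or>
     (\<exists>U\<in>couplings T. U ** (flag_J \<otimes>\<^sub>m mat 1) \<noteq> (flag_J \<otimes>\<^sub>m mat 1) ** U)"

definition flag_inputs :: "(complex^'n^'n) set \<Rightarrow> 'n flag_vec set" where
  "flag_inputs R = {flag_embed \<psi> | \<psi>. norm \<psi> = 1 \<and> ray_proj \<psi> \<in> R}"

text \<open>
  Reading the flag locates the input on its orbit, as an angle modulo \<open>2 \<pi>\<close> relative to the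
  reference of the reading device.
\<close>

definition reads_flag :: "(complex^'n::finite^'n) set \<Rightarrow> ('n flag_vec \<Rightarrow> real) \<Rightarrow> bool" where
  "reads_flag R \<theta> \<longleftrightarrow>
     (\<forall>v\<in>flag_inputs R. \<forall>\<alpha>. \<exists>k::int. \<theta> (exp_J \<alpha> v) = \<theta> v + \<alpha> + 2 * pi * of_int k)"

text \<open>Coherent control by the reading: the flag is turned back by the angle read.\<close>

definition flag_control_by ::
    "(complex^'n::finite^'n) set \<Rightarrow> ('n flag_vec \<Rightarrow> real) \<Rightarrow> ('n flag_vec \<Rightarrow> 'n flag_vec) \<Rightarrow> bool" where
  "flag_control_by R \<theta> C \<longleftrightarrow> (\<forall>v\<in>flag_inputs R. C v = exp_J (- \<theta> v) v)"

text \<open>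
  Interference of two inputs after the control \<^term>\<open>C\<close> has acted on both: a balanced
  two-path interferometer with relative phase \<open>\<beta>\<close> between the arms, whose recombined output port
  carries the vector \<open>(C v + exp (\<beta> J) (C w)) / 2\<close>.
\<close>

definition interference_test ::
    "(complex^'n::finite^'n) set \<Rightarrow> ('n flag_vec \<Rightarrow> 'n flag_vec) \<Rightarrow> real \<Rightarrow>
     ('n flag_vec \<Rightarrow> 'n flag_vec \<Rightarrow> real) \<Rightarrow> bool" where
  "interference_test R C \<beta> p \<longleftrightarrow>
     (\<forall>v\<in>flag_inputs R. \<forall>w\<in>flag_inputs R.
        p v w = (norm ((1/2) *\<^sub>R (C v + exp_J \<beta> (C w))))\<^sup>2)"

definition strong_phase_access ::
    "('n::finite, 'e::finite) flag_theory \<Rightarrow> (complex^'n^'n) set \<Rightarrow> bool" where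
  "strong_phase_access T R \<longleftrightarrow>
     real_flag_theory T \<and> access_branch T \<and>
     (\<exists>\<theta>\<in>flag_readings T. reads_flag R \<theta> \<and>
        (\<exists>C\<in>flag_controls T. flag_control_by R \<theta> C \<and>
           (\<forall>\<beta>. \<exists>p\<in>flag_tests T. interference_test R C \<beta> p)))"

definition flag_scenario ::
    "('n::finite, 'e::finite) flag_theory \<Rightarrow> (real^('n \<times> 2), 'n) scenario" where
  "flag_scenario T =
     \<lparr>preparations = {v. norm v = 1}, amplitude = inv flag_embed,
      procedures = flag_controls T, pair_tests = flag_tests T\<rparr>"


section \<open>Properties of the representation\<close>

lemma two_cases: "(a::2) = 0 \<or> a = 1"
  using exhaust_2[of a] by auto

lemma forall_two: "(\<forall>a::2. P a) \<longleftrightarrow> P 0 \<and> P 1"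
  using two_cases by metis

lemma UNIV_two: "(UNIV::2 set) = {0, 1}"
  using two_cases by auto

lemma sum_UNIV_pair:
  fixes f :: "'n::finite \<times> 2 \<Rightarrow> 'a::comm_monoid_add"
  shows "(\<Sum>k\<in>UNIV. f k) = (\<Sum>i\<in>UNIV. f (i, 0) + f (i, 1))"
proof -
  have "(\<Sum>k\<in>UNIV. f k) = (\<Sum>i\<in>UNIV. \<Sum>a\<in>UNIV. f (i, a))"
    by (simp add: sum.cartesian_product)
  then show ?thesis by (simp add: UNIV_two)
qed

lemma J_F_flag: "J_F *v flag0 = flag1" "J_F *v flag1 = - flag0"
  by (simp_all add: vec_eq_iff forall_two J_F_def flag0_def flag1_def axis_def
      matrix_vector_mult_def UNIV_two)

lemma flag_J_nth [simp]:
  fixes v :: "'a::finite flag_vec"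
  shows
    "(flag_J *v v) $ (i, 0) = - v $ (i, 1)"
    "(flag_J *v v) $ (i, 1) = v $ (i, 0)"
proof -
  have *: "(\<Sum>j\<in>UNIV. (if i = j then 1 else 0) * f j) = f i" for f :: "'a \<Rightarrow> real"
    by (simp add: if_distrib[of "\<lambda>x. x * _"] cong: if_cong)
  show "(flag_J *v v) $ (i, 0) = - v $ (i, 1)"
    using *[of "\<lambda>j. - v $ (j, 1)"]
    by (simp add: flag_J_def tensor_mat_def J_F_def matrix_vector_mult_def sum_UNIV_pair mat_def)
  show "(flag_J *v v) $ (i, 1) = v $ (i, 0)"
    using *[of "\<lambda>j. v $ (j, 0)"]
    by (simp add: flag_J_def tensor_mat_def J_F_def matrix_vector_mult_def sum_UNIV_pair mat_def)
qed

lemma flag_vec_eq_iff: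
  fixes v w :: "'n::finite flag_vec"
  shows "v = w \<longleftrightarrow> (\<forall>i. v $ (i, 0) = w $ (i, 0) \<and> v $ (i, 1) = w $ (i, 1))"
proof -
  have "v $ k = w $ k" if *: "\<forall>i. v $ (i, 0) = w $ (i, 0) \<and> v $ (i, 1) = w $ (i, 1)" for k
  proof -
    obtain i a where k: "k = (i, a)" by (rule prod.exhaust)
    from two_cases[of a] show ?thesis
    proof
      assume "a = 0"
      then show ?thesis unfolding k using * by blast
    next
      assume "a = 1"
      then show ?thesis unfolding k using * by blast
    qed
  qed
  then show ?thesis by (metis vec_eq_iff)
qed

lemma flag_J_flag_J: "flag_J *v (flag_J *v v) = - v"
  by (simp add: flag_vec_eq_iff)

lemma flag_embed_nth [simp]:
  "flag_embed \<psi> $ (i, 0) = Re (\<psi> $ i)" "flag_embed \<psi> $ (i, 1) = Im (\<psi> $ i)"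
  by (simp_all add: flag_embed_def tensor_vec_def flag0_def flag1_def axis_def)

lemma bij_flag_embed: "bij (flag_embed :: complex^'n::finite \<Rightarrow> _)"
proof (rule bijI)
  show "inj (flag_embed :: complex^'n \<Rightarrow> _)"
    by (rule injI) (simp add: flag_vec_eq_iff vec_eq_iff complex_eq_iff)
  have "flag_embed (\<chi> i. Complex (v $ (i, 0)) (v $ (i, 1))) = v" for v :: "'n flag_vec"
    by (simp add: flag_vec_eq_iff)
  then show "surj (flag_embed :: complex^'n \<Rightarrow> _)" by (rule surjI)
qed

lemma norm_flag_embed: "norm (flag_embed \<psi>) = norm (\<psi> :: complex^'n::finite)"
  by (simp add: norm_vec_def L2_set_def sum_UNIV_pair cmod_def)

lemma exp_J_eq: "exp_J \<alpha> v = cos \<alpha> *\<^sub>R v + sin \<alpha> *\<^sub>R (flag_J *v v)"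
proof -
  have even: "((*v) flag_J ^^ (2 * m)) v = (-1) ^ m *\<^sub>R v" for m
    by (induction m) (simp_all add: matrix_vector_mult_scaleR flag_J_flag_J)
  then have odd: "((*v) flag_J ^^ (2 * m + 1)) v = (-1) ^ m *\<^sub>R (flag_J *v v)" for m
    by (simp add: matrix_vector_mult_scaleR)
  have "(\<alpha> ^ k / fact k) *\<^sub>R (((*v) flag_J ^^ k) v) =
      (cos_coeff k *\<^sub>R \<alpha> ^ k) *\<^sub>R v + (sin_coeff k *\<^sub>R \<alpha> ^ k) *\<^sub>R (flag_J *v v)" for k
  proof (cases "even k")
    case True
    then obtain m where "k = 2 * m" by (rule evenE)
    then show ?thesis by (simp add: even cos_coeff_def sin_coeff_def)
  next
    case False
    then obtain m where k: "k = 2 * m + 1" by (rule oddE)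
    show ?thesis unfolding k odd by (simp add: cos_coeff_def sin_coeff_def)
  qed
  moreover have "(\<lambda>k. (cos_coeff k *\<^sub>R \<alpha> ^ k) *\<^sub>R v + (sin_coeff k *\<^sub>R \<alpha> ^ k) *\<^sub>R (flag_J *v v)) sums
      (cos \<alpha> *\<^sub>R v + sin \<alpha> *\<^sub>R (flag_J *v v))"
    by (intro sums_add sums_scaleR_left cos_converges sin_converges)
  ultimately show ?thesis
    unfolding exp_J_def by (simp add: sums_iff)
qed

lemma flag_embed_phase: "flag_embed (cis \<alpha> *s \<psi>) = exp_J \<alpha> (flag_embed \<psi>)"
  by (simp add: exp_J_eq flag_vec_eq_iff algebra_simps)

lemma ray_proj_phase: "ray_proj (cis \<alpha> *s \<psi>) = ray_proj \<psi>"
proof -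
  have "(cis \<alpha> * a) * cnj (cis \<alpha> * b) = a * cnj b" for a b
  proof -
    have "(cis \<alpha> * a) * cnj (cis \<alpha> * b) = (cis \<alpha> * cnj (cis \<alpha>)) * (a * cnj b)"
      by (simp add: algebra_simps)
    then show ?thesis by (simp add: cis_cnj cis_mult)
  qed
  then show ?thesis by (simp add: ray_proj_def vec_eq_iff)
qed

text \<open>Complex rays correspond exactly to the orbits of the flag phase.\<close>

lemma ray_proj_eq_iff_orbit:
  fixes \<psi> \<phi> :: "complex^'n::finite"
  assumes "norm \<psi> = 1" and "norm \<phi> = 1"
  shows "ray_proj \<psi> = ray_proj \<phi> \<longleftrightarrow> (\<exists>\<alpha>. flag_embed \<phi> = exp_J \<alpha> (flag_embed \<psi>))"
proof
  assume eq: "ray_proj \<psi> = ray_proj \<phi>"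
  have e: "\<psi> $ i * cnj (\<psi> $ j) = \<phi> $ i * cnj (\<phi> $ j)" for i j
    using arg_cong[OF eq, of "\<lambda>M. M $ i $ j"] by (simp add: ray_proj_def)
  have "\<phi> \<noteq> 0" using assms by auto
  then obtain j where j: "\<phi> $ j \<noteq> 0" by (auto simp: vec_eq_iff)
  have "(cmod (\<psi> $ j))\<^sup>2 = (cmod (\<phi> $ j))\<^sup>2"
    using e[of j j] by (metis complex_norm_square of_real_eq_iff)
  then have nj: "cmod (\<psi> $ j) = cmod (\<phi> $ j)" by simp
  then have pj: "\<psi> $ j \<noteq> 0" using j by auto
  define c where "c = cnj (\<psi> $ j) / cnj (\<phi> $ j)"
  have "cmod c = 1" using nj j by (simp add: c_def norm_divide)
  then have "c = cis (Arg c)"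
    by (metis cis_Arg_unique norm_eq_zero rcis_cmod_Arg rcis_def mult_1 of_real_1)
  moreover have "\<phi> = c *s \<psi>"
    using e j by (simp add: vec_eq_iff c_def divide_simps mult.commute)
  ultimately have "flag_embed \<phi> = exp_J (Arg c) (flag_embed \<psi>)"
    by (metis flag_embed_phase)
  then show "\<exists>\<alpha>. flag_embed \<phi> = exp_J \<alpha> (flag_embed \<psi>)" ..
next
  assume "\<exists>\<alpha>. flag_embed \<phi> = exp_J \<alpha> (flag_embed \<psi>)"
  then obtain \<alpha> where "flag_embed \<phi> = flag_embed (cis \<alpha> *s \<psi>)"
    by (auto simp: flag_embed_phase)
  then have "\<phi> = cis \<alpha> *s \<psi>" using bij_flag_embed by (metis bij_def injD)
  then show "ray_proj \<psi> = ray_proj \<phi>" by (simp add: ray_proj_phase)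
qed

end

theory Submission
  imports Defs
begin

text \<open>
  Turning an input back by its reading \<open>\<theta>\<close> sends every point of an orbit to the same vector,
  because \<open>\<theta>\<close> moves by \<open>\<alpha>\<close> modulo \<open>2 \<pi>\<close> along the orbit. This vector is the representative of
  the ray. Interference at relative phase \<open>\<beta>\<close> has probability
  \<open>(1 + Re (exp (i \<beta>) z)) / 2\<close>, where \<open>z\<close> is the overlap of the representatives, so
  \<open>\<beta> = 0\<close> and \<open>\<beta> = \<pi> / 2\<close> determine \<open>z\<close>.
\<close>

lemma inv_flag_embed [simp]: "inv flag_embed (flag_embed \<psi>) = (\<psi> :: complex^'n::finite)"
  by (simp add: bij_flag_embed bij_is_inj)

lemma flag_embed_inv [simp]: "flag_embed (inv flag_embed v) = (v :: 'n::finite flag_vec)"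
  by (simp add: bij_flag_embed bij_is_surj surj_f_inv_f)

lemma norm_cis_smult [simp]: "norm (cis \<alpha> *s \<psi>) = norm (\<psi> :: complex^'n::finite)"
  by (simp add: norm_vec_def norm_mult)

lemma braket_smult_right: "braket \<phi> (c *s \<psi>) = c * braket \<phi> \<psi>"
  by (simp add: braket_def sum_distrib_left algebra_simps)

text \<open>The real inner product on the flag space retains only the real part of the complex one,
  so the imaginary part becomes visible only after a relative phase is applied.\<close>

lemma inner_flag_embed:
  "flag_embed \<phi> \<bullet> flag_embed \<psi> = Re (braket \<phi> (\<psi> :: complex^'n::finite))"
  by (simp add: inner_vec_def sum_UNIV_pair braket_def)

lemma interference_probability:
  fixes \<phi> \<psi> :: "complex^'n::finite"
  assumes "norm \<phi> = 1" and "norm \<psi> = 1"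
  shows "(norm ((1/2) *\<^sub>R (flag_embed \<phi> + exp_J \<beta> (flag_embed \<psi>))))\<^sup>2 =
    (1 + Re (cis \<beta> * braket \<phi> \<psi>)) / 2"
proof -
  let ?v = "flag_embed \<phi>" and ?w = "flag_embed (cis \<beta> *s \<psi>)"
  have "(norm (?v + ?w))\<^sup>2 = (norm ?v)\<^sup>2 + (norm ?w)\<^sup>2 + 2 * (?v \<bullet> ?w)"
    by (simp add: power2_norm_eq_inner inner_add inner_commute algebra_simps)
  also have "\<dots> = 2 + 2 * Re (cis \<beta> * braket \<phi> \<psi>)"
    \<comment> \<open>Both arms are unit vectors, and the phase of the second arm leaves the overlap
      as the factor \<open>cis \<beta>\<close>.\<close>
    by (simp only: norm_flag_embed norm_cis_smult assms inner_flag_embed braket_smult_right)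
      simp
  finally show ?thesis
    by (simp add: flag_embed_phase[symmetric] power_mult_distrib power2_eq_square)
qed

text \<open>The control of \<open>flag_control_by\<close> pulled back along
  \<open>flag_embed\<close>, since a phase convention takes values in complex vectors.\<close>

definition turn_back :: "('n::finite flag_vec \<Rightarrow> real) \<Rightarrow> complex^'n \<Rightarrow> complex^'n" where
  "turn_back \<theta> \<psi> = cis (- \<theta> (flag_embed \<psi>)) *s \<psi>"

lemma turn_back_phase:
  assumes "reads_flag R \<theta>" and "norm \<psi> = 1" and "ray_proj \<psi> \<in> R"
  shows "turn_back \<theta> (cis \<alpha> *s \<psi>) = turn_back \<theta> \<psi>"
proof -
  have "flag_embed \<psi> \<in> flag_inputs R"
    using assms by (auto simp: flag_inputs_def)
  then obtain k :: int where
    k: "\<theta> (exp_J \<alpha> (flag_embed \<psi>)) = \<theta> (flag_embed \<psi>) + \<alpha> + 2 * pi * of_int k"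
    using assms(1) unfolding reads_flag_def by blast
  \<comment> \<open>The shift of the reading by \<alpha> cancels the phase of the input; only a
    whole number of turns is left over.\<close>
  have "cis (- \<theta> (flag_embed (cis \<alpha> *s \<psi>))) * cis \<alpha> =
      cis (- \<theta> (flag_embed \<psi>)) * cis (2 * pi * of_int (- k))"
    by (simp add: flag_embed_phase k cis_mult)
  also have "\<dots> = cis (- \<theta> (flag_embed \<psi>))"
    using cis_multiple_2pi[of "of_int (- k)"] by simp
  finally show ?thesis
    by (simp add: turn_back_def vector_smult_assoc)
qed

text \<open>Unit vectors with the same projector lie on one flag orbit, hence differ by a phase; so
  \<open>turn_back\<close> descends to rays of the domain.\<close>

lemma turn_back_cong:
  assumes "reads_flag R \<theta>" and "norm \<psi> = 1" and "norm \<phi> = 1"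
    and "ray_proj \<phi> = ray_proj \<psi>" and "ray_proj \<psi> \<in> R"
  shows "turn_back \<theta> \<phi> = turn_back \<theta> \<psi>"
proof -
  obtain \<alpha> where "flag_embed \<phi> = exp_J \<alpha> (flag_embed \<psi>)"
    using ray_proj_eq_iff_orbit[OF assms(2,3)] assms(4) by auto
  then have "\<phi> = cis \<alpha> *s \<psi>"
    by (metis flag_embed_phase inv_flag_embed)
  then show ?thesis
    using turn_back_phase[OF assms(1,2,5)] by simp
qed

text \<open>A function of the ray needs some vector to start from; on rays of the domain the outcome
  does not depend on which one \<open>SOME\<close> picks, by \<open>turn_back_cong\<close>.\<close>

definition reading_convention ::
    "('n::finite flag_vec \<Rightarrow> real) \<Rightarrow> complex^'n^'n \<Rightarrow> complex^'n" where
  "reading_convention \<theta> P = turn_back \<theta> (SOME \<psi>. norm \<psi> = 1 \<and> ray_proj \<psi> = P)"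

lemma reading_convention_ray_proj:
  assumes "reads_flag R \<theta>" and "norm \<psi> = 1" and "ray_proj \<psi> \<in> R"
  shows "reading_convention \<theta> (ray_proj \<psi>) = turn_back \<theta> \<psi>"
proof -
  let ?\<phi> = "SOME \<phi>. norm \<phi> = 1 \<and> ray_proj \<phi> = ray_proj \<psi>"
  have "norm ?\<phi> = 1 \<and> ray_proj ?\<phi> = ray_proj \<psi>"
    by (rule someI[of _ \<psi>]) (simp add: assms)
  then show ?thesis
    unfolding reading_convention_def using turn_back_cong assms by blast
qed

lemma phase_convention_reading:
  assumes "R \<subseteq> rays" and "reads_flag R \<theta>"
  shows "phase_convention R (reading_convention \<theta>)"
  unfolding phase_convention_def
proof
  fix P assume "P \<in> R"
  with assms(1) obtain \<psi> where "norm \<psi> = 1" and "P = ray_proj \<psi>"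
    by (auto simp: rays_def)
  with \<open>P \<in> R\<close> show "norm (reading_convention \<theta> P) = 1 \<and> P = ray_proj (reading_convention \<theta> P)"
    using reading_convention_ray_proj[OF assms(2)]
    by (simp add: turn_back_def ray_proj_phase)
qed

text \<open>Passes from the scenario, which describes inputs through \<open>inv flag_embed\<close>,
  to \<open>flag_inputs\<close>, where readings, controls and tests are specified.\<close>

lemma flag_scenario_inputE:
  assumes "v \<in> inputs (flag_scenario T) R"
  obtains \<psi> where "v = flag_embed \<psi>" and "norm \<psi> = 1" and "ray_proj \<psi> \<in> R"
    and "prepared_ray (flag_scenario T) v = ray_proj \<psi>" and "v \<in> flag_inputs R"
proof (rule that[of "inv flag_embed v"])
  show n: "norm (inv flag_embed v) = 1"
    using assms norm_flag_embed[of "inv flag_embed v"] by (simp add: inputs_def flag_scenario_def)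
  show r: "ray_proj (inv flag_embed v) \<in> R"
    using assms by (simp add: inputs_def flag_scenario_def prepared_ray_def)
  show "v \<in> flag_inputs R"
    unfolding flag_inputs_def using n r by (metis (mono_tags, lifting) flag_embed_inv mem_Collect_eq)
qed (simp_all add: prepared_ray_def flag_scenario_def)

text \<open>Links the device to the convention: the control itself prepares the representative, so
  its output depends on the input only through the ray.\<close>

lemma flag_control_input:
  assumes "reads_flag R \<theta>" and "flag_control_by R \<theta> C" and "v \<in> inputs (flag_scenario T) R"
  shows "C v = flag_embed (reading_convention \<theta> (prepared_ray (flag_scenario T) v))"
  using assms(3)
proof (rule flag_scenario_inputE)
  fix \<psi>
  assume v: "v = flag_embed \<psi>" "norm \<psi> = 1" "ray_proj \<psi> \<in> R"
    "prepared_ray (flag_scenario T) v = ray_proj \<psi>" "v \<in> flag_inputs R"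
  have "C v = flag_embed (turn_back \<theta> \<psi>)"
    using assms(2) v(5) unfolding v(1) by (simp add: flag_control_by_def turn_back_def flag_embed_phase)
  then show ?thesis
    using reading_convention_ray_proj[OF assms(1)] v by simp
qed

lemma prepared_ray_in_domain: "v \<in> inputs \<S> R \<Longrightarrow> prepared_ray \<S> v \<in> R"
  by (simp add: inputs_def)

lemma operational_reading_convention:
  assumes "R \<subseteq> rays" and "reads_flag R \<theta>" and "flag_control_by R \<theta> C" and "C \<in> flag_controls T"
  shows "operational_phase_convention (flag_scenario T) R (reading_convention \<theta>)"
  unfolding operational_phase_convention_def
\<comment> \<open>The flag control serves as the one procedure common to all inputs.\<close>
proof (intro conjI bexI[of _ C] ballI)
  let ?S = "flag_scenario T"
  show pc: "phase_convention R (reading_convention \<theta>)"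
    using assms(1,2) by (rule phase_convention_reading)
  show "C \<in> procedures ?S"
    using assms(4) by (simp add: flag_scenario_def)
  fix v assume v: "v \<in> inputs ?S R"
  note Cv = flag_control_input[OF assms(2,3) v]
  show "C v \<in> preparations ?S"
    using pc prepared_ray_in_domain[OF v]
    unfolding Cv by (simp add: flag_scenario_def norm_flag_embed phase_convention_def)
  show "amplitude ?S (C v) = reading_convention \<theta> (prepared_ray ?S v)"
    unfolding Cv by (simp add: flag_scenario_def)
qed

lemma definite_overlap:
  assumes "R \<subseteq> rays" and "reads_flag R \<theta>" and "flag_control_by R \<theta> C"
    and tests: "\<And>\<beta>. \<exists>p\<in>flag_tests T. interference_test R C \<beta> p"
  shows "definite_datum (flag_scenario T) R
    (\<lambda>P Q. braket (reading_convention \<theta> P) (reading_convention \<theta> Q))"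
proof -
  let ?S = "flag_scenario T"
  let ?\<Gamma> = "\<lambda>v. reading_convention \<theta> (prepared_ray ?S v)"
  obtain p q where p: "p \<in> flag_tests T" "interference_test R C 0 p"
    and q: "q \<in> flag_tests T" "interference_test R C (pi / 2) q"
    using tests by blast
  have prob: "r v w = (1 + Re (cis \<beta> * braket (?\<Gamma> v) (?\<Gamma> w))) / 2"
    if r: "interference_test R C \<beta> r" and v: "v \<in> inputs ?S R" and w: "w \<in> inputs ?S R"
    for r \<beta> v w
  proof -
    have "v \<in> flag_inputs R" "w \<in> flag_inputs R"
      using v w by (auto elim: flag_scenario_inputE)
    with r have "r v w = (norm ((1/2) *\<^sub>R (C v + exp_J \<beta> (C w))))\<^sup>2"
      by (simp add: interference_test_def)
    also have "\<dots> = (1 + Re (cis \<beta> * braket (?\<Gamma> v) (?\<Gamma> w))) / 2"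
      unfolding flag_control_input[OF assms(2,3) v] flag_control_input[OF assms(2,3) w]
      using phase_convention_reading[OF assms(1,2)] prepared_ray_in_domain[OF v]
        prepared_ray_in_domain[OF w]
      by (intro interference_probability) (auto simp: phase_convention_def)
    finally show ?thesis .
  qed
  show ?thesis
    unfolding definite_datum_def
  proof (intro exI conjI ballI)
    show "set [p, q] \<subseteq> pair_tests ?S"
      using p q by (simp add: flag_scenario_def)
    fix v w assume "v \<in> inputs ?S R" "w \<in> inputs ?S R"
    \<comment> \<open>With overlap z the tests give (1 + Re z) / 2 and (1 - Im z) / 2, because Re (i
      z) = - Im z; hence the opposite sign in the second component.\<close>
    then show "(\<lambda>xs. Complex (2 * xs ! 0 - 1) (1 - 2 * xs ! 1)) (map (\<lambda>r. r v w) [p, q]) =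
        braket (?\<Gamma> v) (?\<Gamma> w)"
      by (simp add: prob[OF p(2)] prob[OF q(2)] complex_eq_iff field_simps)
  qed
qed

theorem theorem9:
  fixes T :: "('n::finite, 'e::finite) flag_theory"
    and R :: "(complex^'n^'n) set"
  assumes "R \<subseteq> rays"
    and "strong_phase_access T R"
  shows "(\<exists>\<Gamma>. operational_phase_convention (flag_scenario T) R \<Gamma>) \<and>
         overlap_determinable (flag_scenario T) R"
proof -
  obtain \<theta> C where "reads_flag R \<theta>" "flag_control_by R \<theta> C" "C \<in> flag_controls T"
    and "\<And>\<beta>. \<exists>p\<in>flag_tests T. interference_test R C \<beta> p"
    using assms(2) unfolding strong_phase_access_def by blast
  then show ?thesis
    using operational_reading_convention[OF assms(1)] definite_overlap[OF assms(1)]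
    unfolding overlap_determinable_def by blast
qed

end
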